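(* Let $\alpha$ be a finite alphabet, $\tau:\alpha\to\alpha$ an involution, $\Delta_\alpha=\{(a,a,a)\}_{a\in\alpha}$, and $\mathrm{crs}(\alpha/\tau)$ a complete system of representatives of $\alpha/\tau$. For any $L\subset\mathrm{crs}(\alpha/\tau)$ and any nanophrases $(\mathcal{A}_1,P_1)$ and $(\mathcal{A}_2,P_2)$ over $\alpha$: if $(\mathcal{A}_1,P_1)\simeq_{\Delta_\alpha}(\mathcal{A}_2,P_2)$, then $\mathcal{U}_L((\mathcal{A}_1,P_1))\simeq_{S_0}\mathcal{U}_L((\mathcal{A}_2,P_2))$.
   Context: **Nanophrases.** An involution is a self-map whose square is the identity (possibly the identity). An $\alpha$-alphabet is a finite set $\mathcal{A}$ with a projection $\mathcal{A}\to\alpha$, $A\mapsto|A|$. A nanophrase of length $k$ over $\alpha$ is a pair $(\mathcal{A},P)$ with $\mathcal{A}$ an $\alpha$-alphabet and $P=w_1|\cdots|w_k$ a sequence of $k$ (possibly empty) words in $\mathcal{A}$ such that every letter of $\mathcal{A}$ occurs exactly twice in $w_1\cdots w_k$. Isomorphism of nanophrases: a projection-preserving bijection of alphabets carrying components to corresponding components. **$S$-homotopy.** For $(\alpha,\tau)$ and $S\subset\alpha^3$, $\simeq_S$ is the equivalence relation generated by isomorphisms and the moves (with $x,y,z,t$ words in the remaining letters, possibly containing the separator $|$): (H1) $(\mathcal{A},xAAy)\to(\mathcal{A}\setminus\{A\},xy)$; (H2) $(\mathcal{A},xAByBAz)\to(\mathcal{A}\setminus\{A,B\},xyz)$ if $\tau(|A|)=|B|$;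 (H3) $(\mathcal{A},xAByACzBCt)\to(\mathcal{A},xBAyCAzCBt)$ if $(|A|,|B|,|C|)\in S$. **Target.** $\alpha_0=\{a,b\}$ with $\tau_0:a\leftrightarrow b$ and $S_0=\{(a,a,a),(b,b,b)\}$; $S_0$-homotopy is taken with respect to $\tau_0$. **The map $\mathcal{U}_L$.** An orbit of $\tau$ is free if it has two elements; $\widetilde{|A|}$ is the orbit of $|A|$. For a letter $A$, $\mathrm{sign}_L(A)=1$ if $|A|\in L$ and $\widetilde{|A|}$ is free; $\mathrm{sign}_L(A)=-1$ if $|A|\in\tau(L)$ and $\widetilde{|A|}$ is free; and $\mathrm{sign}_L(A)=0$ otherwise. For a nanophrase $(\mathcal{A},P)$ over $\alpha$, $\mathcal{U}_L((\mathcal{A},P))$ is the nanophrase over $\alpha_0$ (defined up to isomorphism) obtained by deleting (both occurrences of) all letters $A$ with $\mathrm{sign}_L(A)=0$, keeping all separators, and giving each remaining letter $A$ the projection $a$ if $\mathrm{sign}_L(A)=1$ and $b$ if $\mathrm{sign}_L(A)=-1$. *)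

theory Defs
  imports "HOL-Library.Infinite_Typeclass" "HOL-Combinatorics.Orbits"
begin

section \<open>Nanophrases\<close>

text \<open>
  The alphabet is a finite set of elements of a type of letters. The projection is a total
  function, but only its values on the alphabet are relevant: two nanophrases that differ only in
  the projection outside the alphabet are isomorphic.
\<close>

datatype ('l, 'a) nanophrase =
  Nanophrase (letters: "'l set") (proj: "'l \<Rightarrow> 'a") (phrase: "'l list list")

definition is_nanophrase :: "'a set \<Rightarrow> ('l, 'a) nanophrase \<Rightarrow> bool" where
  "is_nanophrase \<alpha> N \<longleftrightarrow>
     finite (letters N) \<and>
     proj N ` letters N \<subseteq> \<alpha> \<and>
     set (concat (phrase N)) \<subseteq> letters N \<and>
     (\<forall>A \<in> letters N. count_list (concat (phrase N)) A = 2)"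

definition isomorphic :: "('l, 'a) nanophrase \<Rightarrow> ('l, 'a) nanophrase \<Rightarrow> bool" where
  "isomorphic N N' \<longleftrightarrow>
     (\<exists>f. bij_betw f (letters N) (letters N') \<and>
          (\<forall>A \<in> letters N. proj N' (f A) = proj N A) \<and>
          phrase N' = map (map f) (phrase N))"

section \<open>Homotopy\<close>

datatype 'l symbol = Letter 'l | Bar

text \<open>
  Splitting at the separators is a bijection from the words in letters and separators onto the
  nonempty sequences of words. The phrase of length 0 is not in its image; no move applies to it.
\<close>

fun split_bars :: "'l symbol list \<Rightarrow> 'l list list" where
  "split_bars [] = [[]]"
| "split_bars (Bar # s) = [] # split_bars s"
| "split_bars (Letter A # s) = (A # hd (split_bars s)) # tl (split_bars s)"

text \<open>
  In each move, \<open>x\<close>, \<open>y\<close>, \<open>z\<close>, \<open>t\<close> may contain separators. The displayed letters are pairwise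
  distinct and do not occur in \<open>x\<close>, \<open>y\<close>, \<open>z\<close>, \<open>t\<close>, because every letter of a nanophrase occurs
  exactly twice.
\<close>

inductive homotopy_step ::
  "'a set \<Rightarrow> ('a \<Rightarrow> 'a) \<Rightarrow> ('a \<times> 'a \<times> 'a) set
     \<Rightarrow> ('l, 'a) nanophrase \<Rightarrow> ('l, 'a) nanophrase \<Rightarrow> bool"
  for \<alpha> \<tau> S where
  iso: "homotopy_step \<alpha> \<tau> S N N'"
    if "is_nanophrase \<alpha> N" "is_nanophrase \<alpha> N'" "isomorphic N N'"
| H1: "homotopy_step \<alpha> \<tau> S
         (Nanophrase \<A> p (split_bars (x @ [Letter A, Letter A] @ y)))
         (Nanophrase (\<A> - {A}) p (split_bars (x @ y)))"
    if "is_nanophrase \<alpha> (Nanophrase \<A> p (split_bars (x @ [Letter A, Letter A] @ y)))"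
| H2: "homotopy_step \<alpha> \<tau> S
         (Nanophrase \<A> p (split_bars (x @ [Letter A, Letter B] @ y @ [Letter B, Letter A] @ z)))
         (Nanophrase (\<A> - {A, B}) p (split_bars (x @ y @ z)))"
    if "is_nanophrase \<alpha>
          (Nanophrase \<A> p (split_bars (x @ [Letter A, Letter B] @ y @ [Letter B, Letter A] @ z)))"
       "\<tau> (p A) = p B"
| H3: "homotopy_step \<alpha> \<tau> S
         (Nanophrase \<A> p (split_bars
            (x @ [Letter A, Letter B] @ y @ [Letter A, Letter C] @ z @ [Letter B, Letter C] @ t)))
         (Nanophrase \<A> p (split_bars
            (x @ [Letter B, Letter A] @ y @ [Letter C, Letter A] @ z @ [Letter C, Letter B] @ t)))"
    if "is_nanophrase \<alpha> (Nanophrase \<A> p (split_bars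
          (x @ [Letter A, Letter B] @ y @ [Letter A, Letter C] @ z @ [Letter B, Letter C] @ t)))"
       "(p A, p B, p C) \<in> S"

text \<open>
  The type of letters is infinite, so that the inverses of the first two moves always find new
  letters. Any finite alphabets are then represented, up to renaming, in this one type.
\<close>

definition homotopic ::
  "'a set \<Rightarrow> ('a \<Rightarrow> 'a) \<Rightarrow> ('a \<times> 'a \<times> 'a) set
     \<Rightarrow> ('l :: infinite, 'a) nanophrase \<Rightarrow> ('l, 'a) nanophrase \<Rightarrow> bool" where
  "homotopic \<alpha> \<tau> S N N' \<longleftrightarrow>
     is_nanophrase \<alpha> N \<and> is_nanophrase \<alpha> N' \<and> equivclp (homotopy_step \<alpha> \<tau> S) N N'"

section \<open>Involutions and their orbits\<close>

definition involution_on :: "'a set \<Rightarrow> ('a \<Rightarrow> 'a) \<Rightarrow> bool" where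
  "involution_on \<alpha> \<tau> \<longleftrightarrow> (\<forall>x \<in> \<alpha>. \<tau> x \<in> \<alpha> \<and> \<tau> (\<tau> x) = x)"

definition complete_rep_system :: "'a set \<Rightarrow> ('a \<Rightarrow> 'a) \<Rightarrow> 'a set \<Rightarrow> bool" where
  "complete_rep_system \<alpha> \<tau> R \<longleftrightarrow>
     R \<subseteq> \<alpha> \<and> (\<forall>X \<in> orbit \<tau> ` \<alpha>. \<exists>!r. r \<in> R \<and> r \<in> X)"

definition free_orbit :: "('a \<Rightarrow> 'a) \<Rightarrow> 'a \<Rightarrow> bool" where
  "free_orbit \<tau> x \<longleftrightarrow> card (orbit \<tau> x) = 2"

definition diagonal3 :: "'a set \<Rightarrow> ('a \<times> 'a \<times> 'a) set" where
  "diagonal3 \<alpha> = {(x, x, x) | x. x \<in> \<alpha>}"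

section \<open>The two-letter target and the map\<close>

datatype ab = Sym_a | Sym_b

definition \<alpha>\<^sub>0 :: "ab set" where
  "\<alpha>\<^sub>0 = {Sym_a, Sym_b}"

fun \<tau>\<^sub>0 :: "ab \<Rightarrow> ab" where
  "\<tau>\<^sub>0 Sym_a = Sym_b"
| "\<tau>\<^sub>0 Sym_b = Sym_a"

definition S\<^sub>0 :: "(ab \<times> ab \<times> ab) set" where
  "S\<^sub>0 = {(Sym_a, Sym_a, Sym_a), (Sym_b, Sym_b, Sym_b)}"

definition sign :: "('a \<Rightarrow> 'a) \<Rightarrow> 'a set \<Rightarrow> ('l, 'a) nanophrase \<Rightarrow> 'l \<Rightarrow> int" where
  "sign \<tau> L N A =
     (if proj N A \<in> L \<and> free_orbit \<tau> (proj N A) then 1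
      else if proj N A \<in> \<tau> ` L \<and> free_orbit \<tau> (proj N A) then -1
      else 0)"

definition U :: "('a \<Rightarrow> 'a) \<Rightarrow> 'a set \<Rightarrow> ('l, 'a) nanophrase \<Rightarrow> ('l, ab) nanophrase" where
  "U \<tau> L N = Nanophrase
     {A \<in> letters N. sign \<tau> L N A \<noteq> 0}
     (\<lambda>A. if sign \<tau> L N A = 1 then Sym_a else Sym_b)
     (map (filter (\<lambda>A. sign \<tau> L N A \<noteq> 0)) (phrase N))"

end

theory Submission
  imports Defs
begin

text \<open>
  It suffices to follow a single generator of the homotopy relation through \<^term>\<open>U \<tau> L\<close>. The map
  deletes letters and relabels the others, and both are decided by the projection alone: the sign
  of a letter is a function \<open>signum_of\<close> of its projection, so the surviving letters have the same
  signs before and after a move. Deletion also commutes with splitting at separators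
  (\<open>split_bars_keep\<close>), so a move on \<open>N\<close> is seen by \<^term>\<open>U \<tau> L N\<close> as the same rewriting of words with
  some of the displayed letters missing. What remains is that the letters displayed in one move
  survive or disappear together, and that the surviving ones satisfy the side condition over the
  two-letter alphabet. If they disappear, both sides have the same image.

  For the first move there is nothing to compare. In the third move the three projections are equal,
  since the triple lies on the diagonal, hence so are the three signs. The second move is the only
  place where the choice of \<open>L\<close> among the representatives matters: the displayed letters have
  projections \<open>x\<close> and \<open>\<tau> x\<close>, and their signs are opposite (\<open>signum_of_involution\<close>) because a free
  orbit cannot meet \<open>L\<close> in both of its points. Signs that are opposite vanish together, and otherwise
  give the labels that \<^term>\<open>\<tau>\<^sub>0\<close> exchanges.
\<close>

section \<open>The sign of a projection\<close>

definition signum_of :: "('a \<Rightarrow> 'a) \<Rightarrow> 'a set \<Rightarrow> 'a \<Rightarrow> int" where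
  "signum_of \<tau> L x =
     (if x \<in> L \<and> free_orbit \<tau> x then 1
      else if x \<in> \<tau> ` L \<and> free_orbit \<tau> x then -1
      else 0)"

lemma sign_eq_signum_of: "sign \<tau> L N A = signum_of \<tau> L (proj N A)"
  by (simp add: sign_def signum_of_def)

text \<open>
  The orbit of \<open>x\<close> is generated from \<open>\<tau> x\<close>; it contains \<open>x\<close> because \<open>\<tau> (\<tau> x) = x\<close>.
\<close>

lemma orbit_involution:
  assumes "involution_on \<alpha> \<tau>" and "x \<in> \<alpha>"
  shows "orbit \<tau> x = {x, \<tau> x}"
proof
  have "y = x \<or> y = \<tau> x" if "y \<in> orbit \<tau> x" for y
    using that assms by induction (auto simp: involution_on_def)
  then show "orbit \<tau> x \<subseteq> {x, \<tau> x}"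
    by auto
  have "\<tau> (\<tau> x) \<in> orbit \<tau> x"
    by (intro orbit.intros)
  then show "{x, \<tau> x} \<subseteq> orbit \<tau> x"
    using assms by (auto simp: involution_on_def intro: orbit.intros)
qed

lemma signum_of_involution:
  assumes inv: "involution_on \<alpha> \<tau>" and reps: "complete_rep_system \<alpha> \<tau> R" and "L \<subseteq> R"
    and x: "x \<in> \<alpha>"
  shows "signum_of \<tau> L (\<tau> x) = - signum_of \<tau> L x"
proof -
  have \<tau>x: "\<tau> x \<in> \<alpha>" and \<tau>\<tau>: "\<tau> (\<tau> x) = x"
    using inv x by (auto simp: involution_on_def)
  have "L \<subseteq> \<alpha>"
    using \<open>L \<subseteq> R\<close> reps by (auto simp: complete_rep_system_def)
  then have swap: "\<tau> x \<in> \<tau> ` L \<longleftrightarrow> x \<in> L" "x \<in> \<tau> ` L \<longleftrightarrow> \<tau> x \<in> L"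
    using inv \<tau>\<tau> by (force simp: involution_on_def)+
  have orbits: "orbit \<tau> x = {x, \<tau> x}" "orbit \<tau> (\<tau> x) = {x, \<tau> x}"
    using orbit_involution[OF inv x] orbit_involution[OF inv \<tau>x] \<tau>\<tau> by auto
  have "\<not> (x \<in> L \<and> \<tau> x \<in> L)" if "free_orbit \<tau> x"
  proof
    assume both: "x \<in> L \<and> \<tau> x \<in> L"
    have "\<exists>!r. r \<in> R \<and> r \<in> {x, \<tau> x}"
      using reps x orbits(1) unfolding complete_rep_system_def by blast
    then have "\<tau> x = x"
      using both \<open>L \<subseteq> R\<close> by blast
    then show False
      using that orbits(1) by (simp add: free_orbit_def)
  qed
  moreover have "free_orbit \<tau> (\<tau> x) \<longleftrightarrow> free_orbit \<tau> x"
    by (simp add: free_orbit_def orbits)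
  ultimately show ?thesis
    by (auto simp: signum_of_def swap)
qed

definition label_of :: "int \<Rightarrow> ab" where
  "label_of s = (if s = 1 then Sym_a else Sym_b)"

lemma \<tau>\<^sub>0_label_of:
  assumes "signum_of \<tau> L x \<noteq> 0"
  shows "\<tau>\<^sub>0 (label_of (signum_of \<tau> L x)) = label_of (- signum_of \<tau> L x)"
  using assms by (auto simp: label_of_def signum_of_def split: if_splits)

section \<open>Deleting letters from words with separators\<close>

fun keeps :: "('l \<Rightarrow> bool) \<Rightarrow> 'l symbol \<Rightarrow> bool" where
  "keeps Q (Letter A) = Q A"
| "keeps Q Bar = True"

lemma split_bars_nonempty: "split_bars s \<noteq> []"
  by (induction s rule: split_bars.induct) auto

text \<open>
  Separators are never deleted, so the division into components is unaffected.
\<close>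

lemma split_bars_keep: "split_bars (filter (keeps Q) s) = map (filter Q) (split_bars s)"
proof (induction s rule: split_bars.induct)
  case (3 A s)
  then show ?case
    using split_bars_nonempty[of s] by (cases "split_bars s") auto
qed auto

lemma set_concat_split_bars: "set (concat (split_bars s)) = {A. Letter A \<in> set s}"
proof (induction s rule: split_bars.induct)
  case (3 A s)
  then show ?case
    using split_bars_nonempty[of s] by (cases "split_bars s") auto
qed auto

lemma displayed_letter_in_alphabet:
  assumes "is_nanophrase \<alpha> (Nanophrase \<A> p (split_bars s))" and "Letter A \<in> set s"
  shows "A \<in> \<A>" and "p A \<in> \<alpha>"
  using assms set_concat_split_bars[of s] by (auto simp: is_nanophrase_def)

section \<open>The map on nanophrases\<close>

lemma U_split_bars:
  "U \<tau> L (Nanophrase \<A> p (split_bars s)) =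
     Nanophrase {A \<in> \<A>. signum_of \<tau> L (p A) \<noteq> 0} (\<lambda>A. label_of (signum_of \<tau> L (p A)))
       (split_bars (filter (keeps (\<lambda>A. signum_of \<tau> L (p A) \<noteq> 0)) s))"
  by (simp add: U_def sign_eq_signum_of split_bars_keep label_of_def)

lemma is_nanophrase_U:
  assumes "is_nanophrase \<alpha> N"
  shows "is_nanophrase \<alpha>\<^sub>0 (U \<tau> L N)"
proof -
  have count: "count_list (filter Q w) A = count_list w A" if "Q A" for Q w and A :: 'b
    using that by (induction w) auto
  show ?thesis
    using assms
    by (auto simp: is_nanophrase_def U_def \<alpha>\<^sub>0_def filter_concat[symmetric] count)
qed

lemma isomorphic_U:
  assumes N: "is_nanophrase \<alpha> N" and "isomorphic N N'"
  shows "isomorphic (U \<tau> L N) (U \<tau> L N')"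
proof -
  obtain f where f: "bij_betw f (letters N) (letters N')"
    and p: "\<And>A. A \<in> letters N \<Longrightarrow> proj N' (f A) = proj N A"
    and ph: "phrase N' = map (map f) (phrase N)"
    using assms(2) by (auto simp: isomorphic_def)
  have same_sign: "sign \<tau> L N' (f A) = sign \<tau> L N A" if "A \<in> letters N" for A
    using p[OF that] by (simp add: sign_eq_signum_of)
  have "bij_betw f (letters (U \<tau> L N)) (letters (U \<tau> L N'))"
  proof (rule bij_betw_subset[OF f])
    show "f ` letters (U \<tau> L N) = letters (U \<tau> L N')"
      using same_sign by (auto simp: U_def bij_betw_imp_surj_on[OF f, symmetric])
  qed (auto simp: U_def)
  moreover have "phrase (U \<tau> L N') = map (map f) (phrase (U \<tau> L N))"
  proof -
    have "filter (\<lambda>A. sign \<tau> L N' A \<noteq> 0) (map f w) = map f (filter (\<lambda>A. sign \<tau> L N A \<noteq> 0) w)"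
      if "w \<in> set (phrase N)" for w
    proof -
      have "set w \<subseteq> letters N"
        using N that by (auto simp: is_nanophrase_def)
      then show ?thesis
        by (auto simp: filter_map same_sign intro!: arg_cong[of _ _ "map f"] filter_cong)
    qed
    then show ?thesis
      by (simp add: U_def ph)
  qed
  ultimately show ?thesis
    unfolding isomorphic_def using same_sign by (intro exI[of _ f]) (auto simp: U_def)
qed

section \<open>The map on homotopies\<close>

text \<open>
  When the displayed letters have sign zero, both sides of the move have the same image, hence the
  reflexive closure.
\<close>

lemma homotopy_step_U:
  assumes inv: "involution_on \<alpha> \<tau>" and reps: "complete_rep_system \<alpha> \<tau> R" and "L \<subseteq> R"
    and "homotopy_step \<alpha> \<tau> (diagonal3 \<alpha>) N N'"
  shows "(homotopy_step \<alpha>\<^sub>0 \<tau>\<^sub>0 S\<^sub>0)\<^sup>=\<^sup>= (U \<tau> L N) (U \<tau> L N')"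
  using assms(4)
proof cases
  case iso
  then show ?thesis
    using homotopy_step.iso is_nanophrase_U isomorphic_U by blast
next
  case (H1 \<A> p x A y)
  let ?Q = "\<lambda>A. signum_of \<tau> L (p A) \<noteq> 0"
  note nano = is_nanophrase_U[OF H1(3), of \<tau> L, unfolded U_split_bars]
  show ?thesis
  proof (cases "?Q A")
    case True
    have alphabet: "{l \<in> \<A> - {A}. ?Q l} = {l \<in> \<A>. ?Q l} - {A}"
      by auto
    show ?thesis
      unfolding H1(1,2) U_split_bars alphabet
      using nano True homotopy_step.H1[of \<alpha>\<^sub>0 "{l \<in> \<A>. ?Q l}" _ "filter (keeps ?Q) x" A]
      by simp
  next
    case False
    then have alphabet: "{l \<in> \<A> - {A}. ?Q l} = {l \<in> \<A>. ?Q l}"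
      by auto
    show ?thesis
      unfolding H1(1,2) U_split_bars alphabet using False by simp
  qed
next
  case (H2 \<A> p x A B y z)
  let ?Q = "\<lambda>A. signum_of \<tau> L (p A) \<noteq> 0"
  note nano = is_nanophrase_U[OF H2(3), of \<tau> L, unfolded U_split_bars]
  have "p A \<in> \<alpha>"
    using displayed_letter_in_alphabet[OF H2(3), of A] by simp
  then have opposite: "signum_of \<tau> L (p B) = - signum_of \<tau> L (p A)"
    using signum_of_involution[OF inv reps \<open>L \<subseteq> R\<close>] H2(4) by metis
  show ?thesis
  proof (cases "?Q A")
    case True
    have alphabet: "{l \<in> \<A> - {A, B}. ?Q l} = {l \<in> \<A>. ?Q l} - {A, B}"
      by auto
    show ?thesis
      unfolding H2(1,2) U_split_bars alphabet
      using nano True opposite \<tau>\<^sub>0_label_of[OF True]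
        homotopy_step.H2[of \<alpha>\<^sub>0 "{l \<in> \<A>. ?Q l}" _ "filter (keeps ?Q) x" A B
          "filter (keeps ?Q) y" "filter (keeps ?Q) z" \<tau>\<^sub>0 S\<^sub>0]
      by simp
  next
    case False
    then have alphabet: "{l \<in> \<A> - {A, B}. ?Q l} = {l \<in> \<A>. ?Q l}"
      using opposite by auto
    show ?thesis
      unfolding H2(1,2) U_split_bars alphabet using False opposite by simp
  qed
next
  case (H3 \<A> p x A B y C z t)
  let ?Q = "\<lambda>A. signum_of \<tau> L (p A) \<noteq> 0"
  note nano = is_nanophrase_U[OF H3(3), of \<tau> L, unfolded U_split_bars]
  have same: "p B = p A" "p C = p A"
    using H3(4) by (auto simp: diagonal3_def)
  show ?thesis
  proof (cases "?Q A")
    case True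
    have "(label_of (signum_of \<tau> L (p A)), label_of (signum_of \<tau> L (p A)),
        label_of (signum_of \<tau> L (p A))) \<in> S\<^sub>0"
      by (simp add: S\<^sub>0_def label_of_def)
    then show ?thesis
      using nano True same
        homotopy_step.H3[of \<alpha>\<^sub>0 "{l \<in> \<A>. ?Q l}" _ "filter (keeps ?Q) x" A B
          "filter (keeps ?Q) y" C "filter (keeps ?Q) z" "filter (keeps ?Q) t"
          S\<^sub>0 \<tau>\<^sub>0]
      by (simp add: H3(1,2) U_split_bars)
  next
    case False
    then show ?thesis
      using same by (simp add: H3(1,2) U_split_bars)
  qed
qed

theorem theorem3:
  fixes \<alpha> :: "'a set" and \<tau> :: "'a \<Rightarrow> 'a" and R L :: "'a set"
    and N\<^sub>1 N\<^sub>2 :: "('l :: infinite, 'a) nanophrase"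
  assumes "finite \<alpha>"
    and "involution_on \<alpha> \<tau>"
    and "complete_rep_system \<alpha> \<tau> R"
    and "L \<subseteq> R"
    and "is_nanophrase \<alpha> N\<^sub>1"
    and "is_nanophrase \<alpha> N\<^sub>2"
    and "homotopic \<alpha> \<tau> (diagonal3 \<alpha>) N\<^sub>1 N\<^sub>2"
  shows "homotopic \<alpha>\<^sub>0 \<tau>\<^sub>0 S\<^sub>0 (U \<tau> L N\<^sub>1) (U \<tau> L N\<^sub>2)"
proof -
  let ?E = "equivclp (homotopy_step \<alpha>\<^sub>0 \<tau>\<^sub>0 S\<^sub>0) :: ('l, ab) nanophrase \<Rightarrow> _"
  have image_of_step: "?E (U \<tau> L N) (U \<tau> L N')"
    if "homotopy_step \<alpha> \<tau> (diagonal3 \<alpha>) N N'" for N N' :: "('l, 'a) nanophrase"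
    using homotopy_step_U[OF assms(2-4) that] by (auto intro: r_into_equivclp)
  have "equivclp (homotopy_step \<alpha> \<tau> (diagonal3 \<alpha>)) N\<^sub>1 N\<^sub>2"
    using assms(7) by (simp add: homotopic_def)
  then have "?E (U \<tau> L N\<^sub>1) (U \<tau> L N\<^sub>2)"
  proof (induction rule: equivclp_induct)
    case base
    show ?case by simp
  next
    case (step N N')
    then have "?E (U \<tau> L N) (U \<tau> L N')"
      using image_of_step
      by (auto intro: equivclp_sym)
    with step.IH show ?case
      by (rule equivclp_trans)
  qed
  then show ?thesis
    using is_nanophrase_U assms(5,6) by (auto simp: homotopic_def)
qed

end
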